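(* Let $\mathbf A$ be a Łukasiewicz near semiring. The ideal lattice $\langle \mathrm{Id}(\mathbf A),\cap,\vee,\{0\},A\rangle$ is isomorphic to the congruence lattice $\mathrm{Con}(\mathbf A)$ (via $I\mapsto\theta(I)$, where $a\,\theta(I)\,b$ iff $a^{\alpha}b,\,b^{\alpha}a\in I$). Consequently $\mathrm{Id}(\mathbf A)$ is an algebraic and distributive lattice.
   Context: An $\iota$-near semiring is an algebra $\langle A,+,\cdot,{}^{\alpha},0,1\rangle$ of type $\langle 2,2,1,0,0\rangle$ such that $\langle A,+\rangle$ is a join semilattice with least element $0$ and greatest element $1$ (order $x\le y$ iff $x+y=y$), $x\cdot1=x=1\cdot x$, $(x+y)\cdot z=xz+yz$, $x0=0x=0$, $(x^{\alpha})^{\alpha}=x$, and $x\le y$ implies $y^{\alpha}\le x^{\alpha}$. A Łukasiewicz near semiring is an $\iota$-near semiring satisfying $(x y^{\alpha})^{\alpha} y^{\alpha}=(y x^{\alpha})^{\alpha} x^{\alpha}$. Juxtaposition $xy$ denotes $x\cdot y$. An ideal of $\mathbf A$ is a set $I\subseteq A$ with $0\in I$ such that (I1) if $ab^{\alpha}\in I$ and $b\in I$ then $a\in I$; (I2) if $a^{\alpha}b\in I$ and $b^{\alpha}a\in I$ then $(ac)^{\alpha}(bc)\in I$ and $(ca)^{\alpha}(cb)\in I$ for every $c\in A$. $\mathrm{Id}(\mathbf A)$ is the set of ideals, ordered by inclusion, with $I\wedge J=I\cap J$ and $I\vee J=\langle I\cup J\rangle$, the least ideal containing $I\cup J$. 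*)

theory Defs
  imports "HOL-Algebra.Ring" "HOL-Algebra.Complete_Lattice"
begin

text \<open>
  Only the signature of \<open>ring\<close> records is reused; none of the ring axioms are assumed.
\<close>

record 'a nsr = "'a ring" +
  alpha :: "'a \<Rightarrow> 'a"  (\<open>_\<^sup>\<alpha>\<index>\<close> [1000] 999)

definition nsr_le :: "('a, 'm) nsr_scheme \<Rightarrow> 'a \<Rightarrow> 'a \<Rightarrow> bool" (infix \<open>\<preceq>\<index>\<close> 50)
  where "x \<preceq>\<^bsub>A\<^esub> y \<longleftrightarrow> x \<oplus>\<^bsub>A\<^esub> y = y"

text \<open>
  Multiplication is neither associative nor left distributive in general.
\<close>

locale iota_near_semiring =
  fixes A :: "('a, 'm) nsr_scheme" (structure)
  assumes add_closed: "\<lbrakk>x \<in> carrier A; y \<in> carrier A\<rbrakk> \<Longrightarrow> x \<oplus> y \<in> carrier A"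
    and mult_closed: "\<lbrakk>x \<in> carrier A; y \<in> carrier A\<rbrakk> \<Longrightarrow> x \<otimes> y \<in> carrier A"
    and alpha_closed: "x \<in> carrier A \<Longrightarrow> x\<^sup>\<alpha> \<in> carrier A"
    and zero_closed: "\<zero> \<in> carrier A"
    and one_closed: "\<one> \<in> carrier A"
    and add_assoc: "\<lbrakk>x \<in> carrier A; y \<in> carrier A; z \<in> carrier A\<rbrakk> \<Longrightarrow>
      (x \<oplus> y) \<oplus> z = x \<oplus> (y \<oplus> z)"
    and add_comm: "\<lbrakk>x \<in> carrier A; y \<in> carrier A\<rbrakk> \<Longrightarrow> x \<oplus> y = y \<oplus> x"
    and add_idem: "x \<in> carrier A \<Longrightarrow> x \<oplus> x = x"
    and zero_least: "x \<in> carrier A \<Longrightarrow> \<zero> \<preceq> x"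
    and one_greatest: "x \<in> carrier A \<Longrightarrow> x \<preceq> \<one>"
    and mult_one_right: "x \<in> carrier A \<Longrightarrow> x \<otimes> \<one> = x"
    and mult_one_left: "x \<in> carrier A \<Longrightarrow> \<one> \<otimes> x = x"
    and right_distrib: "\<lbrakk>x \<in> carrier A; y \<in> carrier A; z \<in> carrier A\<rbrakk> \<Longrightarrow>
      (x \<oplus> y) \<otimes> z = x \<otimes> z \<oplus> y \<otimes> z"
    and mult_zero_right: "x \<in> carrier A \<Longrightarrow> x \<otimes> \<zero> = \<zero>"
    and mult_zero_left: "x \<in> carrier A \<Longrightarrow> \<zero> \<otimes> x = \<zero>"
    and alpha_invol: "x \<in> carrier A \<Longrightarrow> (x\<^sup>\<alpha>)\<^sup>\<alpha> = x"
    and alpha_antitone: "\<lbrakk>x \<in> carrier A; y \<in> carrier A; x \<preceq> y\<rbrakk> \<Longrightarrow> y\<^sup>\<alpha> \<preceq> x\<^sup>\<alpha>"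

locale lukasiewicz_near_semiring = iota_near_semiring +
  assumes lukasiewicz: "\<lbrakk>x \<in> carrier A; y \<in> carrier A\<rbrakk> \<Longrightarrow>
    (x \<otimes> y\<^sup>\<alpha>)\<^sup>\<alpha> \<otimes> y\<^sup>\<alpha> = (y \<otimes> x\<^sup>\<alpha>)\<^sup>\<alpha> \<otimes> x\<^sup>\<alpha>"

definition nsr_ideal :: "('a, 'm) nsr_scheme \<Rightarrow> 'a set \<Rightarrow> bool"
  where "nsr_ideal A I \<longleftrightarrow>
    I \<subseteq> carrier A \<and> \<zero>\<^bsub>A\<^esub> \<in> I \<and>
    (\<forall>a\<in>carrier A. \<forall>b\<in>carrier A. a \<otimes>\<^bsub>A\<^esub> b\<^sup>\<alpha>\<^bsub>A\<^esub> \<in> I \<and> b \<in> I \<longrightarrow> a \<in> I) \<and>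
    (\<forall>a\<in>carrier A. \<forall>b\<in>carrier A.
       a\<^sup>\<alpha>\<^bsub>A\<^esub> \<otimes>\<^bsub>A\<^esub> b \<in> I \<and> b\<^sup>\<alpha>\<^bsub>A\<^esub> \<otimes>\<^bsub>A\<^esub> a \<in> I \<longrightarrow>
       (\<forall>c\<in>carrier A.
          (a \<otimes>\<^bsub>A\<^esub> c)\<^sup>\<alpha>\<^bsub>A\<^esub> \<otimes>\<^bsub>A\<^esub> (b \<otimes>\<^bsub>A\<^esub> c) \<in> I \<and>
          (c \<otimes>\<^bsub>A\<^esub> a)\<^sup>\<alpha>\<^bsub>A\<^esub> \<otimes>\<^bsub>A\<^esub> (c \<otimes>\<^bsub>A\<^esub> b) \<in> I))"

definition ideal_generated :: "('a, 'm) nsr_scheme \<Rightarrow> 'a set \<Rightarrow> 'a set"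
  where "ideal_generated A X = \<Inter>{I. nsr_ideal A I \<and> X \<subseteq> I}"

definition ideal_lattice :: "('a, 'm) nsr_scheme \<Rightarrow> 'a set gorder"
  where "ideal_lattice A = \<lparr>carrier = {I. nsr_ideal A I}, eq = (=), le = (\<subseteq>)\<rparr>"

definition nsr_congruence :: "('a, 'm) nsr_scheme \<Rightarrow> ('a \<times> 'a) set \<Rightarrow> bool"
  where "nsr_congruence A R \<longleftrightarrow>
    equiv (carrier A) R \<and>
    (\<forall>(a, b)\<in>R. \<forall>(c, d)\<in>R. (a \<oplus>\<^bsub>A\<^esub> c, b \<oplus>\<^bsub>A\<^esub> d) \<in> R) \<and>
    (\<forall>(a, b)\<in>R. \<forall>(c, d)\<in>R. (a \<otimes>\<^bsub>A\<^esub> c, b \<otimes>\<^bsub>A\<^esub> d) \<in> R) \<and>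
    (\<forall>(a, b)\<in>R. (a\<^sup>\<alpha>\<^bsub>A\<^esub>, b\<^sup>\<alpha>\<^bsub>A\<^esub>) \<in> R)"

definition congruence_lattice :: "('a, 'm) nsr_scheme \<Rightarrow> ('a \<times> 'a) set gorder"
  where "congruence_lattice A = \<lparr>carrier = {R. nsr_congruence A R}, eq = (=), le = (\<subseteq>)\<rparr>"

definition ideal_rel :: "('a, 'm) nsr_scheme \<Rightarrow> 'a set \<Rightarrow> ('a \<times> 'a) set"
  where "ideal_rel A I = {(a, b). a \<in> carrier A \<and> b \<in> carrier A \<and>
    a\<^sup>\<alpha>\<^bsub>A\<^esub> \<otimes>\<^bsub>A\<^esub> b \<in> I \<and> b\<^sup>\<alpha>\<^bsub>A\<^esub> \<otimes>\<^bsub>A\<^esub> a \<in> I}"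

definition bounded_lattice_iso ::
    "('a, 'c) gorder_scheme \<Rightarrow> ('b, 'd) gorder_scheme \<Rightarrow> ('a \<Rightarrow> 'b) \<Rightarrow> bool"
  where "bounded_lattice_iso L M h \<longleftrightarrow>
    bounded_lattice L \<and> bounded_lattice M \<and>
    bij_betw h (carrier L) (carrier M) \<and> join_pres L M h \<and> meet_pres L M h \<and>
    h \<bottom>\<^bsub>L\<^esub> = \<bottom>\<^bsub>M\<^esub> \<and> h \<top>\<^bsub>L\<^esub> = \<top>\<^bsub>M\<^esub>"

definition compact_element :: "('a, 'c) gorder_scheme \<Rightarrow> 'a \<Rightarrow> bool"
  where "compact_element L c \<longleftrightarrow> c \<in> carrier L \<and>
    (\<forall>X\<subseteq>carrier L. c \<sqsubseteq>\<^bsub>L\<^esub> \<Squnion>\<^bsub>L\<^esub> X \<longrightarrow> (\<exists>F\<subseteq>X. finite F \<and> c \<sqsubseteq>\<^bsub>L\<^esub> \<Squnion>\<^bsub>L\<^esub> F))"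

definition algebraic_lattice :: "('a, 'c) gorder_scheme \<Rightarrow> bool"
  where "algebraic_lattice L \<longleftrightarrow> complete_lattice L \<and>
    (\<forall>x\<in>carrier L. \<exists>K. (\<forall>c\<in>K. compact_element L c) \<and> x = \<Squnion>\<^bsub>L\<^esub> K)"

definition distributive_lattice :: "('a, 'c) gorder_scheme \<Rightarrow> bool"
  where "distributive_lattice L \<longleftrightarrow> lattice L \<and>
    (\<forall>x\<in>carrier L. \<forall>y\<in>carrier L. \<forall>z\<in>carrier L.
       x \<sqinter>\<^bsub>L\<^esub> (y \<squnion>\<^bsub>L\<^esub> z) = (x \<sqinter>\<^bsub>L\<^esub> y) \<squnion>\<^bsub>L\<^esub> (x \<sqinter>\<^bsub>L\<^esub> z))"

end

theory Submission
  imports Defs HOL.Hull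
begin

text \<open>
  In a Lukasiewicz near semiring, \<open>x \<le> y\<close> holds iff \<open>x y\<^sup>\<alpha> = 0\<close>, and the join is the term
  \<open>x + y = ((x y\<^sup>\<alpha>)\<^sup>\<alpha> y\<^sup>\<alpha>)\<^sup>\<alpha>\<close>; so sums need no separate treatment when checking that an
  equivalence is a congruence, and if \<open>a\<^sup>\<alpha> b\<close> and \<open>b\<^sup>\<alpha> a\<close> are congruent to \<open>0\<close> then \<open>a\<^sup>\<alpha>\<close> and
  \<open>b\<^sup>\<alpha>\<close> are both congruent to \<open>a\<^sup>\<alpha> + b\<^sup>\<alpha>\<close>, so \<open>a\<close> and \<open>b\<close> are congruent. Hence the map sending a
  congruence to its \<open>0\<close>-class is inverse to \<open>I \<mapsto> \<theta>(I)\<close>. The ideals form a closure system closed under directed unions, which gives an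
  algebraic lattice. For distributivity, the join of two congruences consists of chains: if
  \<open>a \<in> I \<inter> (J \<or> K)\<close> then meeting with \<open>a\<close> pushes a chain from \<open>0\<close> to \<open>a\<close> into \<open>I\<close>.
\<close>

section \<open>Set systems ordered by inclusion\<close>

text \<open>Both lattices of the theorem are instances, with \<open>P\<close> the property of being
  an ideal or of being a congruence, so completeness and the formulas for joins and meets are proved
  only once.\<close>

definition incl_order :: "('a set \<Rightarrow> bool) \<Rightarrow> 'a set gorder"
  where "incl_order P = \<lparr>carrier = {S. P S}, eq = (=), le = (\<subseteq>)\<rparr>"

lemma incl_order_simps [simp]:
  "carrier (incl_order P) = {S. P S}"
  "S \<sqsubseteq>\<^bsub>incl_order P\<^esub> T \<longleftrightarrow> S \<subseteq> T"
  "S .=\<^bsub>incl_order P\<^esub> T \<longleftrightarrow> S = T"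
  by (simp_all add: incl_order_def)

lemma partial_order_incl_order: "partial_order (incl_order P)"
  by unfold_locales (auto simp: incl_order_def)

lemma is_lub_incl_order_iff:
  assumes "\<forall>S\<in>D. P S"
  shows "is_lub (incl_order P) T D \<longleftrightarrow> P T \<and> \<Union>D \<subseteq> T \<and> (\<forall>S. P S \<and> \<Union>D \<subseteq> S \<longrightarrow> T \<subseteq> S)"
proof -
  have "Upper (incl_order P) D = {S. P S \<and> \<Union>D \<subseteq> S}"
    using assms by (auto simp: Upper_def)
  then show ?thesis
    by (auto simp: least_def)
qed

lemma is_glb_incl_order_iff:
  assumes "\<forall>S\<in>D. P S"
  shows "is_glb (incl_order P) T D \<longleftrightarrow> P T \<and> T \<subseteq> \<Inter>D \<and> (\<forall>S. P S \<and> S \<subseteq> \<Inter>D \<longrightarrow> S \<subseteq> T)"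
proof -
  have "Lower (incl_order P) D = {S. P S \<and> S \<subseteq> \<Inter>D}"
    using assms by (auto simp: Lower_def)
  then show ?thesis
    by (auto simp: greatest_def)
qed

text \<open>The supremum is chosen by a description operator; antisymmetry of inclusion makes the
  least upper bound unique and so fixes the chosen value.\<close>

lemma sup_incl_order_eqI:
  assumes "\<forall>S\<in>D. P S" "P T" "\<Union>D \<subseteq> T" "\<And>S. P S \<Longrightarrow> \<Union>D \<subseteq> S \<Longrightarrow> T \<subseteq> S"
  shows "\<Squnion>\<^bsub>incl_order P\<^esub> D = T"
  unfolding sup_def is_lub_incl_order_iff [OF assms(1)]
  using assms(2-) by (intro some_equality) auto

lemma inf_incl_order_eqI:
  assumes "\<forall>S\<in>D. P S" "P T" "T \<subseteq> \<Inter>D" "\<And>S. P S \<Longrightarrow> S \<subseteq> \<Inter>D \<Longrightarrow> S \<subseteq> T"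
  shows "\<Sqinter>\<^bsub>incl_order P\<^esub> D = T"
  unfolding inf_def is_glb_incl_order_iff [OF assms(1)]
  using assms(2-) by (intro some_equality) auto

text \<open>\<open>Inter_closed\<close> speaks of nonempty families because
  \<open>\<Inter>{}\<close> is the universe of the type rather than \<open>U\<close>;
  \<open>top_closed\<close> plays the part of the empty intersection.\<close>

locale closure_system =
  fixes U :: "'a set" and P :: "'a set \<Rightarrow> bool"
  assumes subset_top: "P S \<Longrightarrow> S \<subseteq> U"
    and top_closed: "P U"
    and Inter_closed: "D \<noteq> {} \<Longrightarrow> (\<And>S. S \<in> D \<Longrightarrow> P S) \<Longrightarrow> P (\<Inter>D)"
begin

lemma hull_closed: "X \<subseteq> U \<Longrightarrow> P (P hull X)"
  unfolding hull_def using top_closed by (intro Inter_closed) auto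

lemma Int_closed: "P S \<Longrightarrow> P T \<Longrightarrow> P (S \<inter> T)"
  using Inter_closed [of "{S, T}"] by auto

lemma Union_subset_top: "\<forall>S\<in>D. P S \<Longrightarrow> \<Union>D \<subseteq> U"
  using subset_top by blast

lemma sup_eq_hull:
  assumes "\<forall>S\<in>D. P S"
  shows "\<Squnion>\<^bsub>incl_order P\<^esub> D = P hull \<Union>D"
  using assms by (intro sup_incl_order_eqI hull_closed Union_subset_top hull_minimal)
    (auto intro: hull_inc)

lemma join_eq_hull: "P S \<Longrightarrow> P T \<Longrightarrow> S \<squnion>\<^bsub>incl_order P\<^esub> T = P hull (S \<union> T)"
  by (simp add: join_def sup_eq_hull)

lemma meet_eq_Int: "P S \<Longrightarrow> P T \<Longrightarrow> S \<sqinter>\<^bsub>incl_order P\<^esub> T = S \<inter> T"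
  unfolding meet_def by (intro inf_incl_order_eqI) (auto intro: Int_closed)

lemma complete_lattice: "complete_lattice (incl_order P)"
proof -
  interpret partial_order "incl_order P"
    by (rule partial_order_incl_order)
  show ?thesis
  proof
    fix D assume "D \<subseteq> carrier (incl_order P)"
    then have D: "\<forall>S\<in>D. P S" by auto
    have "is_lub (incl_order P) (P hull \<Union>D) D"
      using D by (auto simp: is_lub_incl_order_iff hull_closed Union_subset_top
          intro: hull_inc dest: hull_minimal)
    then show "\<exists>S. is_lub (incl_order P) S D" ..
    \<comment> \<open>Adding \<open>U\<close> to the family changes nothing for nonempty
      \<open>D\<close> and gives the right infimum \<open>U\<close> for empty
      \<open>D\<close>.\<close>
    have "P (U \<inter> \<Inter>D)"
      using Inter_closed [of "insert U D"] D top_closed by auto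
    then have "is_glb (incl_order P) (U \<inter> \<Inter>D) D"
      using D subset_top by (auto simp: is_glb_incl_order_iff)
    then show "\<exists>S. is_glb (incl_order P) S D" ..
  qed
qed

sublocale incl: complete_lattice "incl_order P"
  by (rule complete_lattice)

lemma bounded_lattice: "bounded_lattice (incl_order P)"
  ..

lemma lattice: "lattice (incl_order P)"
  ..

lemma top_eq: "\<top>\<^bsub>incl_order P\<^esub> = U"
  using incl.top_greatest subset_top top_closed by (auto simp: greatest_def)

lemma bottom_eq: "\<bottom>\<^bsub>incl_order P\<^esub> = P hull {}"
  using incl.bottom_least hull_closed [of "{}"] hull_minimal [of "{}" _ P]
  by (auto simp: least_def)

text \<open>The hull of a union is the directed union of the hulls of its finite subunions, so hulls of
  single points are compact.\<close>

lemma algebraic_lattice: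
  assumes directed: "\<And>D. D \<noteq> {} \<Longrightarrow> (\<And>S. S \<in> D \<Longrightarrow> P S) \<Longrightarrow>
    (\<And>S T. S \<in> D \<Longrightarrow> T \<in> D \<Longrightarrow> \<exists>V\<in>D. S \<subseteq> V \<and> T \<subseteq> V) \<Longrightarrow> P (\<Union>D)"
  shows "algebraic_lattice (incl_order P)"
proof -
  have compact: "compact_element (incl_order P) (P hull {a})" if a: "a \<in> U" for a
    unfolding compact_element_def
  proof (intro conjI allI impI)
    show "P hull {a} \<in> carrier (incl_order P)"
      using a by (simp add: hull_closed)
    fix D assume "D \<subseteq> carrier (incl_order P)"
      and le: "P hull {a} \<sqsubseteq>\<^bsub>incl_order P\<^esub> \<Squnion>\<^bsub>incl_order P\<^esub> D"
    then have D: "\<forall>S\<in>D. P S" by auto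
    define E where "E = {P hull \<Union>F | F. F \<subseteq> D \<and> finite F}"
    have "P (\<Union>E)"
    proof (rule directed)
      show "E \<noteq> {}"
        unfolding E_def by blast
      show "P S" if "S \<in> E" for S
        using that D unfolding E_def by (auto intro!: hull_closed Union_subset_top)
      fix S T assume "S \<in> E" "T \<in> E"
      then obtain F G where F: "F \<subseteq> D" "finite F" "S = P hull \<Union>F"
        and G: "G \<subseteq> D" "finite G" "T = P hull \<Union>G"
        unfolding E_def by blast
      have "P hull \<Union>(F \<union> G) \<in> E"
        unfolding E_def using F G by blast
      moreover have "S \<subseteq> P hull \<Union>(F \<union> G)" "T \<subseteq> P hull \<Union>(F \<union> G)"
        unfolding F G by (auto intro!: hull_mono)
      ultimately show "\<exists>V\<in>E. S \<subseteq> V \<and> T \<subseteq> V" by blast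
    qed
    moreover have "\<Union>D \<subseteq> \<Union>E"
    proof
      fix x assume "x \<in> \<Union>D"
      then obtain S where S: "S \<in> D" "x \<in> S" by blast
      then have "P hull \<Union>{S} \<in> E"
        unfolding E_def by blast
      with S show "x \<in> \<Union>E"
        by (auto intro: hull_inc)
    qed
    ultimately have "P hull \<Union>D \<subseteq> \<Union>E"
      by (intro hull_minimal)
    moreover have "a \<in> P hull \<Union>D"
      using le D by (auto simp: sup_eq_hull intro: hull_inc)
    \<comment> \<open>Finiteness enters here: the single point \<open>a\<close> lies in one member
      of \<open>E\<close>, and that member comes from a finite subfamily.\<close>
    ultimately obtain F where F: "F \<subseteq> D" "finite F" "a \<in> P hull \<Union>F"
      unfolding E_def by blast
    then have "P (P hull \<Union>F)"
      using D by (intro hull_closed Union_subset_top) blast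
    with F have "P hull {a} \<subseteq> P hull \<Union>F"
      by (intro hull_minimal) auto
    with F D show "\<exists>F\<subseteq>D. finite F \<and> P hull {a} \<sqsubseteq>\<^bsub>incl_order P\<^esub> \<Squnion>\<^bsub>incl_order P\<^esub> F"
      by (intro exI [of _ F]) (simp add: sup_eq_hull subset_iff)
  qed
  show ?thesis
    unfolding algebraic_lattice_def
  proof (intro conjI ballI complete_lattice)
    fix S assume "S \<in> carrier (incl_order P)"
    then have S: "P S" by simp
    \<comment> \<open>A closed set is the join of the hulls of its points, and these hulls are
      compact.\<close>
    define K where "K = (\<lambda>a. P hull {a}) ` S"
    have "\<forall>c\<in>K. compact_element (incl_order P) c"
      unfolding K_def using S subset_top compact by blast
    moreover have "\<Squnion>\<^bsub>incl_order P\<^esub> K = S"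
    proof (rule sup_incl_order_eqI)
      show "\<forall>T\<in>K. P T"
        unfolding K_def using S subset_top by (auto intro!: hull_closed)
      show "\<Union>K \<subseteq> S"
        unfolding K_def using S by (auto dest: hull_minimal [of "{_}" S P, THEN subsetD, rotated 2])
      show "S \<subseteq> T" if "\<Union>K \<subseteq> T" for T
        using that hull_inc [of _ "{_}" P] unfolding K_def by blast
    qed (rule S)
    ultimately show "\<exists>K. (\<forall>c\<in>K. compact_element (incl_order P) c) \<and> S = \<Squnion>\<^bsub>incl_order P\<^esub> K"
      by blast
  qed
qed

end

text \<open>An order isomorphism transports bounds. By surjectivity the join of two images is some
  \<open>h z\<close>; reflecting the order shows that \<open>z\<close> is an upper bound in
  \<open>L\<close>, which gives one inequality, and monotonicity gives the other. Meets are
  dual.\<close>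

lemma bounded_lattice_isoI:
  assumes L: "bounded_lattice L" and M: "bounded_lattice M"
    and bij: "bij_betw h (carrier L) (carrier M)"
    and order: "\<And>x y. x \<in> carrier L \<Longrightarrow> y \<in> carrier L \<Longrightarrow> h x \<sqsubseteq>\<^bsub>M\<^esub> h y \<longleftrightarrow> x \<sqsubseteq>\<^bsub>L\<^esub> y"
  shows "bounded_lattice_iso L M h"
proof -
  interpret L: bounded_lattice L by (rule L)
  interpret M: bounded_lattice M by (rule M)
  have h [simp]: "h x \<in> carrier M" if "x \<in> carrier L" for x
    using bij that by (auto simp: bij_betw_def)
  have surj: "\<exists>x\<in>carrier L. z = h x" if "z \<in> carrier M" for z
    using bij that by (auto simp: bij_betw_def)
  have join: "h (x \<squnion>\<^bsub>L\<^esub> y) = h x \<squnion>\<^bsub>M\<^esub> h y" if xy: "x \<in> carrier L" "y \<in> carrier L" for x y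
  proof -
    obtain z where z: "z \<in> carrier L" "h x \<squnion>\<^bsub>M\<^esub> h y = h z"
      using surj [of "h x \<squnion>\<^bsub>M\<^esub> h y"] xy by auto
    have "x \<sqsubseteq>\<^bsub>L\<^esub> z" "y \<sqsubseteq>\<^bsub>L\<^esub> z"
      using M.join_left [of "h x" "h y"] M.join_right [of "h x" "h y"] xy z by (auto simp: order)
    then have "h (x \<squnion>\<^bsub>L\<^esub> y) \<sqsubseteq>\<^bsub>M\<^esub> h x \<squnion>\<^bsub>M\<^esub> h y"
      using L.join_le xy z by (simp add: order)
    moreover have "h x \<squnion>\<^bsub>M\<^esub> h y \<sqsubseteq>\<^bsub>M\<^esub> h (x \<squnion>\<^bsub>L\<^esub> y)"
      using xy by (intro M.join_le) (simp_all add: order L.join_left L.join_right)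
    ultimately show ?thesis
      using xy by (intro M.le_antisym) simp_all
  qed
  have meet: "h (x \<sqinter>\<^bsub>L\<^esub> y) = h x \<sqinter>\<^bsub>M\<^esub> h y" if xy: "x \<in> carrier L" "y \<in> carrier L" for x y
  proof -
    obtain z where z: "z \<in> carrier L" "h x \<sqinter>\<^bsub>M\<^esub> h y = h z"
      using surj [of "h x \<sqinter>\<^bsub>M\<^esub> h y"] xy by auto
    have "z \<sqsubseteq>\<^bsub>L\<^esub> x" "z \<sqsubseteq>\<^bsub>L\<^esub> y"
      using M.meet_left [of "h x" "h y"] M.meet_right [of "h x" "h y"] xy z by (auto simp: order)
    then have "h x \<sqinter>\<^bsub>M\<^esub> h y \<sqsubseteq>\<^bsub>M\<^esub> h (x \<sqinter>\<^bsub>L\<^esub> y)"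
      using L.meet_le xy z by (simp add: order)
    moreover have "h (x \<sqinter>\<^bsub>L\<^esub> y) \<sqsubseteq>\<^bsub>M\<^esub> h x \<sqinter>\<^bsub>M\<^esub> h y"
      using xy by (intro M.meet_le) (simp_all add: order L.meet_left L.meet_right)
    ultimately show ?thesis
      using xy by (intro M.le_antisym) simp_all
  qed
  have bottom: "h \<bottom>\<^bsub>L\<^esub> = \<bottom>\<^bsub>M\<^esub>"
  proof (rule M.bottom_eq)
    fix z assume "z \<in> carrier M"
    then obtain x where "x \<in> carrier L" "z = h x"
      using surj by blast
    then show "h \<bottom>\<^bsub>L\<^esub> \<sqsubseteq>\<^bsub>M\<^esub> z"
      by (simp add: order)
  qed simp
  have top: "h \<top>\<^bsub>L\<^esub> = \<top>\<^bsub>M\<^esub>"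
  proof (rule M.top_eq)
    fix z assume "z \<in> carrier M"
    then obtain x where "x \<in> carrier L" "z = h x"
      using surj by blast
    then show "z \<sqsubseteq>\<^bsub>M\<^esub> h \<top>\<^bsub>L\<^esub>"
      by (simp add: order)
  qed simp
  show ?thesis
    unfolding bounded_lattice_iso_def join_pres_def meet_pres_def
    by (intro conjI ballI L M bij join meet bottom top L.lattice_axioms M.lattice_axioms)
qed

section \<open>Arithmetic of Lukasiewicz near semirings\<close>

context iota_near_semiring
begin

lemmas closed [simp, intro] = add_closed mult_closed alpha_closed zero_closed one_closed

lemma le_antisym: "\<lbrakk>x \<preceq> y; y \<preceq> x; x \<in> carrier A; y \<in> carrier A\<rbrakk> \<Longrightarrow> x = y"
  unfolding nsr_le_def using add_comm by metis

lemma le_add_left: "\<lbrakk>x \<in> carrier A; y \<in> carrier A\<rbrakk> \<Longrightarrow> x \<preceq> x \<oplus> y"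
  unfolding nsr_le_def using add_assoc add_idem by metis

lemma le_add_right: "\<lbrakk>x \<in> carrier A; y \<in> carrier A\<rbrakk> \<Longrightarrow> y \<preceq> x \<oplus> y"
  using le_add_left add_comm by metis

lemma add_least:
  "\<lbrakk>x \<preceq> z; y \<preceq> z; x \<in> carrier A; y \<in> carrier A; z \<in> carrier A\<rbrakk> \<Longrightarrow> x \<oplus> y \<preceq> z"
  unfolding nsr_le_def using add_assoc by metis

lemma alpha_le_swap: "\<lbrakk>x\<^sup>\<alpha> \<preceq> y; x \<in> carrier A; y \<in> carrier A\<rbrakk> \<Longrightarrow> y\<^sup>\<alpha> \<preceq> x"
  using alpha_antitone [of "x\<^sup>\<alpha>" y] by (simp add: alpha_invol)

lemma le_alpha_swap: "\<lbrakk>x \<preceq> y\<^sup>\<alpha>; x \<in> carrier A; y \<in> carrier A\<rbrakk> \<Longrightarrow> y \<preceq> x\<^sup>\<alpha>"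
  using alpha_antitone [of x "y\<^sup>\<alpha>"] by (simp add: alpha_invol)

lemma alpha_zero: "\<zero>\<^sup>\<alpha> = \<one>"
  by (rule le_antisym) (simp_all add: one_greatest le_alpha_swap [OF zero_least])

lemma alpha_one: "\<one>\<^sup>\<alpha> = \<zero>"
  using alpha_zero alpha_invol by force

lemma mult_mono_left:
  "\<lbrakk>x \<preceq> y; x \<in> carrier A; y \<in> carrier A; z \<in> carrier A\<rbrakk> \<Longrightarrow> x \<otimes> z \<preceq> y \<otimes> z"
  unfolding nsr_le_def using right_distrib by metis

text \<open>Monotonicity in the left factor applied to x \<le> 1 gives x y \<le> 1 y = y.\<close>

lemma mult_le_right: "\<lbrakk>x \<in> carrier A; y \<in> carrier A\<rbrakk> \<Longrightarrow> x \<otimes> y \<preceq> y"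
  using mult_mono_left [OF one_greatest] mult_one_left by fastforce

end

context lukasiewicz_near_semiring
begin

text \<open>At y = 1 the left side of the Lukasiewicz identity is a product with
  \<open>\<one>\<^sup>\<alpha> = \<zero>\<close>, while the right side simplifies to
  \<open>x \<otimes> x\<^sup>\<alpha>\<close>.\<close>

lemma mult_alpha_self: "x \<in> carrier A \<Longrightarrow> x \<otimes> x\<^sup>\<alpha> = \<zero>"
  using lukasiewicz [of x \<one>]
  by (simp add: alpha_one alpha_zero alpha_invol mult_zero_right mult_one_left)

lemma alpha_mult_self: "x \<in> carrier A \<Longrightarrow> x\<^sup>\<alpha> \<otimes> x = \<zero>"
  using mult_alpha_self [of "x\<^sup>\<alpha>"] by (simp add: alpha_invol)

text \<open>Multiplying x \<le> y on the right by \<open>y\<^sup>\<alpha>\<close> gives a product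
  below \<open>y \<otimes> y\<^sup>\<alpha> = \<zero>\<close>. Conversely, the Lukasiewicz identity
  then exhibits \<open>y\<^sup>\<alpha>\<close> as a left multiple of
  \<open>x\<^sup>\<alpha>\<close>, hence below it.\<close>

lemma le_iff_mult_alpha:
  assumes [simp]: "x \<in> carrier A" "y \<in> carrier A"
  shows "x \<preceq> y \<longleftrightarrow> x \<otimes> y\<^sup>\<alpha> = \<zero>"
proof
  assume "x \<preceq> y"
  then have "x \<otimes> y\<^sup>\<alpha> \<preceq> \<zero>"
    using mult_mono_left [of x y "y\<^sup>\<alpha>"] by (simp add: mult_alpha_self)
  then show "x \<otimes> y\<^sup>\<alpha> = \<zero>"
    by (intro le_antisym zero_least) auto
next
  assume "x \<otimes> y\<^sup>\<alpha> = \<zero>"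
  then have "y\<^sup>\<alpha> = (y \<otimes> x\<^sup>\<alpha>)\<^sup>\<alpha> \<otimes> x\<^sup>\<alpha>"
    using lukasiewicz [of x y] by (simp add: alpha_zero mult_one_left)
  then have "y\<^sup>\<alpha> \<preceq> x\<^sup>\<alpha>"
    using mult_le_right [of "(y \<otimes> x\<^sup>\<alpha>)\<^sup>\<alpha>" "x\<^sup>\<alpha>"] by simp
  then show "x \<preceq> y"
    using alpha_le_swap [of y "x\<^sup>\<alpha>"] by (simp add: alpha_invol)
qed

lemma add_eq_term:
  assumes [simp]: "x \<in> carrier A" "y \<in> carrier A"
  shows "x \<oplus> y = ((x \<otimes> y\<^sup>\<alpha>)\<^sup>\<alpha> \<otimes> y\<^sup>\<alpha>)\<^sup>\<alpha>"
proof -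
  \<comment> \<open>\<open>m\<close> turns out to be the meet of \<open>x\<^sup>\<alpha>\<close> and
    \<open>y\<^sup>\<alpha>\<close>, so the claim is De Morgan's law. By the Lukasiewicz identity
    \<open>m\<close> is symmetric in \<open>x\<close> and \<open>y\<close>, which puts it below
    both.\<close>
  define m where "m = (x \<otimes> y\<^sup>\<alpha>)\<^sup>\<alpha> \<otimes> y\<^sup>\<alpha>"
  define z where "z = (x \<oplus> y)\<^sup>\<alpha>"
  have [simp]: "m \<in> carrier A" "z \<in> carrier A"
    by (simp_all add: m_def z_def)
  have "m \<preceq> x\<^sup>\<alpha>" "m \<preceq> y\<^sup>\<alpha>"
    using mult_le_right [of "(x \<otimes> y\<^sup>\<alpha>)\<^sup>\<alpha>" "y\<^sup>\<alpha>"] mult_le_right [of "(y \<otimes> x\<^sup>\<alpha>)\<^sup>\<alpha>" "x\<^sup>\<alpha>"]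
    by (simp_all add: m_def lukasiewicz [of x y])
  then have "x \<oplus> y \<preceq> m\<^sup>\<alpha>"
    by (intro add_least) (simp_all add: le_alpha_swap)
  moreover have "z \<preceq> m"
  proof -
    have x: "x \<preceq> z\<^sup>\<alpha>" and y: "y \<preceq> z\<^sup>\<alpha>"
      by (simp_all add: z_def alpha_invol le_add_left le_add_right)
    have "y \<otimes> z = \<zero>"
      using y by (simp add: le_iff_mult_alpha alpha_invol)
    \<comment> \<open>Since y z = 0, one side of the Lukasiewicz identity for \<open>y\<close> and
      \<open>z\<^sup>\<alpha>\<close> collapses to \<open>z\<close>; the other side has the shape of
      \<open>m\<close> with \<open>z\<^sup>\<alpha>\<close> in place of \<open>x\<close>.\<close>
    then have z: "z = (z\<^sup>\<alpha> \<otimes> y\<^sup>\<alpha>)\<^sup>\<alpha> \<otimes> y\<^sup>\<alpha>"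
      using lukasiewicz [of y "z\<^sup>\<alpha>"] by (simp add: alpha_invol alpha_zero mult_one_left)
    have "(z\<^sup>\<alpha> \<otimes> y\<^sup>\<alpha>)\<^sup>\<alpha> \<otimes> y\<^sup>\<alpha> \<preceq> m"
      unfolding m_def using x by (intro mult_mono_left alpha_antitone) auto
    then show ?thesis
      using z by simp
  qed
  then have "m\<^sup>\<alpha> \<preceq> x \<oplus> y"
    unfolding z_def by (simp add: alpha_le_swap)
  ultimately show ?thesis
    unfolding m_def by (intro le_antisym) auto
qed

section \<open>Ideals and congruences\<close>

text \<open>The last two clauses use (I2) for both orders of the pair and thereby state it as
  compatibility of \<open>ideal_rel A I\<close> with multiplication by \<open>c\<close> on either
  side.\<close>

lemma idealD:
  assumes "nsr_ideal A I"
  shows "I \<subseteq> carrier A" "\<zero> \<in> I"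
    and "\<lbrakk>a \<in> carrier A; a \<otimes> b\<^sup>\<alpha> \<in> I; b \<in> I\<rbrakk> \<Longrightarrow> a \<in> I"
    and "\<lbrakk>(a, b) \<in> ideal_rel A I; c \<in> carrier A\<rbrakk> \<Longrightarrow> (a \<otimes> c, b \<otimes> c) \<in> ideal_rel A I"
    and "\<lbrakk>(a, b) \<in> ideal_rel A I; c \<in> carrier A\<rbrakk> \<Longrightarrow> (c \<otimes> a, c \<otimes> b) \<in> ideal_rel A I"
  using assms unfolding nsr_ideal_def ideal_rel_def by auto

lemma ideal_rel_sym: "(a, b) \<in> ideal_rel A I \<Longrightarrow> (b, a) \<in> ideal_rel A I"
  by (simp add: ideal_rel_def)

lemma ideal_rel_carrier:
  "(a, b) \<in> ideal_rel A I \<Longrightarrow> a \<in> carrier A" "(a, b) \<in> ideal_rel A I \<Longrightarrow> b \<in> carrier A"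
  by (simp_all add: ideal_rel_def)

text \<open>Here \<open>a \<otimes> b\<^sup>\<alpha> = \<zero>\<close> lies in \<open>I\<close>, so
  (I1) applies.\<close>

lemma ideal_downward_closed:
  assumes I: "nsr_ideal A I" and b: "b \<in> I" and "a \<preceq> b" "a \<in> carrier A"
  shows "a \<in> I"
proof -
  have "b \<in> carrier A"
    using b idealD(1) [OF I] by blast
  then have "a \<otimes> b\<^sup>\<alpha> \<in> I"
    using assms idealD(2) [OF I] by (simp add: le_iff_mult_alpha)
  then show ?thesis
    using idealD(3) [OF I] assms by blast
qed

text \<open>Multiplying \<open>a \<theta> b\<close> on the right by \<open>b\<^sup>\<alpha>\<close> gives \<open>a b\<^sup>\<alpha> \<theta> 0\<close>.\<close>

lemma ideal_rel_mult_alpha: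
  assumes I: "nsr_ideal A I" and ab: "(a, b) \<in> ideal_rel A I"
  shows "a \<otimes> b\<^sup>\<alpha> \<in> I"
proof -
  have [simp]: "a \<in> carrier A" "b \<in> carrier A"
    using ab by (auto dest: ideal_rel_carrier)
  have "(a \<otimes> b\<^sup>\<alpha>, b \<otimes> b\<^sup>\<alpha>) \<in> ideal_rel A I"
    using I ab by (intro idealD(4)) auto
  then show ?thesis
    by (simp add: ideal_rel_def mult_alpha_self alpha_zero mult_one_left)
qed

text \<open>An ideal is a union of classes of its own relation: relatedness puts
  \<open>a \<otimes> b\<^sup>\<alpha>\<close> in \<open>I\<close>, and (I1) does the rest.\<close>

lemma ideal_rel_mem:
  "\<lbrakk>nsr_ideal A I; (a, b) \<in> ideal_rel A I; b \<in> I\<rbrakk> \<Longrightarrow> a \<in> I"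
  by (rule idealD(3)) (auto dest: ideal_rel_carrier ideal_rel_mult_alpha)

text \<open>After cancelling the double involution, the two memberships to show are those of
  \<open>a \<otimes> b\<^sup>\<alpha>\<close> and
  \<open>b \<otimes> a\<^sup>\<alpha>\<close>.\<close>

lemma ideal_rel_alpha:
  assumes I: "nsr_ideal A I" and ab: "(a, b) \<in> ideal_rel A I"
  shows "(a\<^sup>\<alpha>, b\<^sup>\<alpha>) \<in> ideal_rel A I"
  using ideal_rel_mult_alpha [OF I ab] ideal_rel_mult_alpha [OF I ideal_rel_sym [OF ab]]
    ideal_rel_carrier [OF ab]
  by (simp add: ideal_rel_def alpha_invol)

text \<open>The element \<open>x\<^sup>\<alpha> \<otimes> z\<close> is related to
  \<open>y\<^sup>\<alpha> \<otimes> z\<close>, which lies in \<open>I\<close>; hence it lies in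
  \<open>I\<close> as well.\<close>

lemma ideal_rel_trans:
  assumes I: "nsr_ideal A I" and ab: "(a, b) \<in> ideal_rel A I" and bc: "(b, c) \<in> ideal_rel A I"
  shows "(a, c) \<in> ideal_rel A I"
proof -
  have *: "x\<^sup>\<alpha> \<otimes> z \<in> I"
    if xy: "(x, y) \<in> ideal_rel A I" and yz: "(y, z) \<in> ideal_rel A I" for x y z
  proof (rule ideal_rel_mem [OF I])
    show "(x\<^sup>\<alpha> \<otimes> z, y\<^sup>\<alpha> \<otimes> z) \<in> ideal_rel A I"
      using I xy yz by (intro idealD(4) ideal_rel_alpha) (auto dest: ideal_rel_carrier)
    show "y\<^sup>\<alpha> \<otimes> z \<in> I"
      using yz by (simp add: ideal_rel_def)
  qed
  show ?thesis
    using * [OF ab bc] * [OF ideal_rel_sym [OF bc] ideal_rel_sym [OF ab]] ab bc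
    by (simp add: ideal_rel_def)
qed

text \<open>Compatibility with sums is automatic because the join is a term.\<close>

lemma congruenceI:
  assumes equiv: "equiv (carrier A) R"
    and left: "\<And>a b c. \<lbrakk>(a, b) \<in> R; c \<in> carrier A\<rbrakk> \<Longrightarrow> (a \<otimes> c, b \<otimes> c) \<in> R"
    and right: "\<And>a b c. \<lbrakk>(a, b) \<in> R; c \<in> carrier A\<rbrakk> \<Longrightarrow> (c \<otimes> a, c \<otimes> b) \<in> R"
    and alpha: "\<And>a b. (a, b) \<in> R \<Longrightarrow> (a\<^sup>\<alpha>, b\<^sup>\<alpha>) \<in> R"
  shows "nsr_congruence A R"
proof -
  have carrier: "a \<in> carrier A \<and> b \<in> carrier A" if "(a, b) \<in> R" for a b
    using equiv_class_eq_iff [OF equiv] that by blast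
  have trans: "(a, c) \<in> R" if "(a, b) \<in> R" "(b, c) \<in> R" for a b c
    using equiv that by (meson equivE transE)
  have mult: "(a \<otimes> c, b \<otimes> d) \<in> R" if "(a, b) \<in> R" "(c, d) \<in> R" for a b c d
    using that carrier left right trans by meson
  have "(a \<oplus> c, b \<oplus> d) \<in> R" if "(a, b) \<in> R" "(c, d) \<in> R" for a b c d
    using that carrier by (simp add: add_eq_term alpha mult)
  with equiv mult alpha show ?thesis
    by (auto simp: nsr_congruence_def)
qed

lemma congruence_ideal_rel:
  assumes I: "nsr_ideal A I"
  shows "nsr_congruence A (ideal_rel A I)"
proof (rule congruenceI)
  show "equiv (carrier A) (ideal_rel A I)"
  proof (rule equivI)
    show "ideal_rel A I \<subseteq> carrier A \<times> carrier A"
      by (auto dest: ideal_rel_carrier)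
    show "refl_on (carrier A) (ideal_rel A I)"
      using idealD(2) [OF I] by (auto intro!: refl_onI simp: ideal_rel_def alpha_mult_self)
    show "sym (ideal_rel A I)"
      by (auto intro: symI ideal_rel_sym)
    show "trans (ideal_rel A I)"
      by (auto intro: transI ideal_rel_trans [OF I])
  qed
qed (auto intro: idealD(4,5) [OF I] ideal_rel_alpha [OF I])

lemma congruenceD:
  assumes "nsr_congruence A R"
  shows "(a, b) \<in> R \<Longrightarrow> a \<in> carrier A" "(a, b) \<in> R \<Longrightarrow> b \<in> carrier A"
    and "a \<in> carrier A \<Longrightarrow> (a, a) \<in> R"
    and "(a, b) \<in> R \<Longrightarrow> (b, a) \<in> R"
    and "\<lbrakk>(a, b) \<in> R; (b, c) \<in> R\<rbrakk> \<Longrightarrow> (a, c) \<in> R"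
    and "\<lbrakk>(a, b) \<in> R; (c, d) \<in> R\<rbrakk> \<Longrightarrow> (a \<oplus> c, b \<oplus> d) \<in> R"
    and "\<lbrakk>(a, b) \<in> R; (c, d) \<in> R\<rbrakk> \<Longrightarrow> (a \<otimes> c, b \<otimes> d) \<in> R"
    and "(a, b) \<in> R \<Longrightarrow> (a\<^sup>\<alpha>, b\<^sup>\<alpha>) \<in> R"
proof -
  have equiv: "equiv (carrier A) R"
    using assms by (simp add: nsr_congruence_def)
  show "(a, b) \<in> R \<Longrightarrow> a \<in> carrier A" "(a, b) \<in> R \<Longrightarrow> b \<in> carrier A"
    "a \<in> carrier A \<Longrightarrow> (a, a) \<in> R" "(a, b) \<in> R \<Longrightarrow> (b, a) \<in> R"
    "\<lbrakk>(a, b) \<in> R; (b, c) \<in> R\<rbrakk> \<Longrightarrow> (a, c) \<in> R"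
    using equiv_class_eq_iff [OF equiv] by auto
qed (use assms in \<open>auto simp: nsr_congruence_def\<close>)

section \<open>Congruences and their zero classes\<close>

definition zero_class :: "('a \<times> 'a) set \<Rightarrow> 'a set"
  where "zero_class R = {a. (a, \<zero>) \<in> R}"

lemma congruence_ideal_rel_zero_class:
  assumes R: "nsr_congruence A R"
  shows "ideal_rel A (zero_class R) = R"
proof (intro subset_antisym subrelI)
  fix a b assume "(a, b) \<in> ideal_rel A (zero_class R)"
  then have ab [simp]: "a \<in> carrier A" "b \<in> carrier A"
    and "(a\<^sup>\<alpha> \<otimes> b, \<zero>) \<in> R" "(b\<^sup>\<alpha> \<otimes> a, \<zero>) \<in> R"
    by (auto simp: ideal_rel_def zero_class_def)
  \<comment> \<open>The join term of \<open>x\<^sup>\<alpha>\<close> and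
    \<open>y\<^sup>\<alpha>\<close> contains \<open>x\<^sup>\<alpha> \<otimes> y\<close>; replacing
    this by 0 reduces the term to \<open>y\<^sup>\<alpha>\<close>.\<close>
  have *: "(x\<^sup>\<alpha> \<oplus> y\<^sup>\<alpha>, y\<^sup>\<alpha>) \<in> R"
    if [simp]: "x \<in> carrier A" "y \<in> carrier A" and xy: "(x\<^sup>\<alpha> \<otimes> y, \<zero>) \<in> R" for x y
  proof -
    have "(((x\<^sup>\<alpha> \<otimes> y)\<^sup>\<alpha> \<otimes> y)\<^sup>\<alpha>, (\<zero>\<^sup>\<alpha> \<otimes> y)\<^sup>\<alpha>) \<in> R"
      using R xy by (intro congruenceD(3,7,8)) auto
    then show ?thesis
      by (simp add: add_eq_term alpha_invol alpha_zero mult_one_left)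
  qed
  have "(a\<^sup>\<alpha> \<oplus> b\<^sup>\<alpha>, b\<^sup>\<alpha>) \<in> R" "(a\<^sup>\<alpha> \<oplus> b\<^sup>\<alpha>, a\<^sup>\<alpha>) \<in> R"
    using * [of a b] * [of b a] \<open>(a\<^sup>\<alpha> \<otimes> b, \<zero>) \<in> R\<close> \<open>(b\<^sup>\<alpha> \<otimes> a, \<zero>) \<in> R\<close>
    by (simp_all add: add_comm [of "b\<^sup>\<alpha>"])
  then have "(a\<^sup>\<alpha>, b\<^sup>\<alpha>) \<in> R"
    using R congruenceD(4,5) by meson
  then show "(a, b) \<in> R"
    using congruenceD(8) [OF R, of "a\<^sup>\<alpha>" "b\<^sup>\<alpha>"] by (simp add: alpha_invol)
next
  \<comment> \<open>Multiply \<open>a\<^sup>\<alpha>\<close> and \<open>b\<^sup>\<alpha>\<close>,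
    which are congruent, on the right by \<open>b\<close> and use
    \<open>b\<^sup>\<alpha> \<otimes> b = \<zero>\<close>.\<close>
  have *: "(a\<^sup>\<alpha> \<otimes> b, \<zero>) \<in> R" if "(a, b) \<in> R" for a b
  proof -
    have "b \<in> carrier A"
      using R that by (rule congruenceD)
    then have "(a\<^sup>\<alpha> \<otimes> b, b\<^sup>\<alpha> \<otimes> b) \<in> R"
      using R that by (intro congruenceD(3,7,8)) auto
    with \<open>b \<in> carrier A\<close> show ?thesis
      by (simp add: alpha_mult_self)
  qed
  fix a b assume "(a, b) \<in> R"
  then show "(a, b) \<in> ideal_rel A (zero_class R)"
    using * congruenceD(1,2,4) [OF R] by (simp add: ideal_rel_def zero_class_def)
qed

text \<open>For (I1), b congruent to 0 makes \<open>a \<otimes> b\<^sup>\<alpha>\<close> congruent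
  to a 1 = a. For (I2), the relation induced by the zero class is already known to be
  \<open>R\<close>, so the condition is compatibility of \<open>R\<close> with
  multiplication.\<close>

lemma ideal_zero_class:
  assumes R: "nsr_congruence A R"
  shows "nsr_ideal A (zero_class R)"
proof -
  note D = congruenceD [OF R]
  have I1: "(a, \<zero>) \<in> R"
    if a: "a \<in> carrier A" and "(a \<otimes> b\<^sup>\<alpha>, \<zero>) \<in> R" "(b, \<zero>) \<in> R" for a b
  proof -
    have "(a \<otimes> b\<^sup>\<alpha>, a \<otimes> \<zero>\<^sup>\<alpha>) \<in> R"
      using that by (intro D(3,7,8)) auto
    then have "(a \<otimes> b\<^sup>\<alpha>, a) \<in> R"
      using a by (simp add: alpha_zero mult_one_right)
    with that show ?thesis
      using D(4,5) by meson
  qed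
  have I2: "(a \<otimes> c, b \<otimes> c) \<in> ideal_rel A (zero_class R)"
    "(c \<otimes> a, c \<otimes> b) \<in> ideal_rel A (zero_class R)"
    if "(a, b) \<in> ideal_rel A (zero_class R)" "c \<in> carrier A" for a b c
    using that unfolding congruence_ideal_rel_zero_class [OF R] by (auto intro: D(3,7))
  show ?thesis
    unfolding nsr_ideal_def
  proof (intro conjI ballI impI)
    show "zero_class R \<subseteq> carrier A" "\<zero> \<in> zero_class R"
      using D(1,3) by (auto simp: zero_class_def)
    show "a \<in> zero_class R"
      if "a \<in> carrier A" "a \<otimes> b\<^sup>\<alpha> \<in> zero_class R \<and> b \<in> zero_class R" for a b
      using that I1 by (auto simp: zero_class_def)
  qed (use I2 in \<open>auto simp: ideal_rel_def\<close>)
qed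

text \<open>For the pair (a, 0) the two defining products are
  \<open>a\<^sup>\<alpha> \<otimes> \<zero> = \<zero>\<close> and
  \<open>\<zero>\<^sup>\<alpha> \<otimes> a = a\<close>.\<close>

lemma zero_class_ideal_rel:
  assumes I: "nsr_ideal A I"
  shows "zero_class (ideal_rel A I) = I"
  using idealD(1,2) [OF I]
  by (auto simp: zero_class_def ideal_rel_def alpha_zero mult_one_left mult_zero_right)

lemma bij_betw_ideal_rel:
  "bij_betw (ideal_rel A) {I. nsr_ideal A I} {R. nsr_congruence A R}"
  by (rule bij_betw_byWitness [where f' = zero_class])
    (auto simp: zero_class_ideal_rel congruence_ideal_rel_zero_class
      congruence_ideal_rel ideal_zero_class)

lemma ideal_rel_mono: "I \<subseteq> J \<Longrightarrow> ideal_rel A I \<subseteq> ideal_rel A J"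
  by (auto simp: ideal_rel_def)

lemma ideal_rel_subset_iff:
  assumes "nsr_ideal A I" "nsr_ideal A J"
  shows "ideal_rel A I \<subseteq> ideal_rel A J \<longleftrightarrow> I \<subseteq> J"
proof
  assume "ideal_rel A I \<subseteq> ideal_rel A J"
  then have "zero_class (ideal_rel A I) \<subseteq> zero_class (ideal_rel A J)"
    by (auto simp: zero_class_def)
  with assms show "I \<subseteq> J"
    by (simp add: zero_class_ideal_rel)
qed (rule ideal_rel_mono)

section \<open>The ideal lattice\<close>

lemma ideal_carrier: "nsr_ideal A (carrier A)"
  by (simp add: nsr_ideal_def)

lemma ideal_Inter:
  assumes "D \<noteq> {}" "\<And>I. I \<in> D \<Longrightarrow> nsr_ideal A I"
  shows "nsr_ideal A (\<Inter>D)"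
proof -
  have "\<Inter>D \<subseteq> carrier A"
    using assms idealD(1) by blast
  then show ?thesis
    using assms(2) unfolding nsr_ideal_def by blast
qed

text \<open>Each of (I1) and (I2) has just two membership premises, so by directedness one member of
  \<open>D\<close> satisfies both and supplies the conclusion.\<close>

lemma ideal_directed_Union:
  assumes ne: "D \<noteq> {}" and D: "\<And>I. I \<in> D \<Longrightarrow> nsr_ideal A I"
    and dir: "\<And>I J. I \<in> D \<Longrightarrow> J \<in> D \<Longrightarrow> \<exists>K\<in>D. I \<subseteq> K \<and> J \<subseteq> K"
  shows "nsr_ideal A (\<Union>D)"
proof -
  have both: "\<exists>K\<in>D. x \<in> K \<and> y \<in> K" if "x \<in> \<Union>D" "y \<in> \<Union>D" for x y
  proof -
    from that obtain I J where "I \<in> D" "J \<in> D" "x \<in> I" "y \<in> J" by blast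
    with dir [of I J] show ?thesis by blast
  qed
  show ?thesis
    unfolding nsr_ideal_def
  proof (intro conjI ballI impI)
    show "\<Union>D \<subseteq> carrier A"
      using D idealD(1) by blast
    show "\<zero> \<in> \<Union>D"
      using ne D idealD(2) by blast
  next
    fix a b
    assume a: "a \<in> carrier A" and "a \<otimes> b\<^sup>\<alpha> \<in> \<Union>D \<and> b \<in> \<Union>D"
    then obtain K where "K \<in> D" "a \<otimes> b\<^sup>\<alpha> \<in> K" "b \<in> K"
      using both by blast
    with a show "a \<in> \<Union>D"
      using D idealD(3) by blast
  next
    fix a b c
    assume abc: "a \<in> carrier A" "b \<in> carrier A" "c \<in> carrier A"
      and "a\<^sup>\<alpha> \<otimes> b \<in> \<Union>D \<and> b\<^sup>\<alpha> \<otimes> a \<in> \<Union>D"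
    then obtain K where K: "K \<in> D" "a\<^sup>\<alpha> \<otimes> b \<in> K" "b\<^sup>\<alpha> \<otimes> a \<in> K"
      using both by blast
    with abc have "(a, b) \<in> ideal_rel A K"
      by (simp add: ideal_rel_def)
    then have "(a \<otimes> c, b \<otimes> c) \<in> ideal_rel A K" "(c \<otimes> a, c \<otimes> b) \<in> ideal_rel A K"
      using D K abc by (auto intro: idealD(4,5))
    with K show "(a \<otimes> c)\<^sup>\<alpha> \<otimes> (b \<otimes> c) \<in> \<Union>D" "(c \<otimes> a)\<^sup>\<alpha> \<otimes> (c \<otimes> b) \<in> \<Union>D"
      by (auto simp: ideal_rel_def)
  qed
qed

lemma closure_system_ideal: "closure_system (carrier A) (nsr_ideal A)"
  using idealD(1) ideal_carrier ideal_Inter by unfold_locales blast+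

section \<open>Congruences as a closure system, and chains of congruences\<close>

lemma congruence_carrier: "nsr_congruence A (carrier A \<times> carrier A)"
  by (rule congruenceI) (auto intro!: equivI refl_onI symI transI)

lemma congruence_Inter:
  assumes "D \<noteq> {}" and D: "\<And>R. R \<in> D \<Longrightarrow> nsr_congruence A R"
  shows "nsr_congruence A (\<Inter>D)"
proof (rule congruenceI)
  show "equiv (carrier A) (\<Inter>D)"
  proof (rule equivI)
    show "\<Inter>D \<subseteq> carrier A \<times> carrier A"
      using assms congruenceD(1,2) by fast
    show "refl_on (carrier A) (\<Inter>D)"
      using D congruenceD(3) by (blast intro: refl_onI)
    show "sym (\<Inter>D)"
      using D congruenceD(4) by (blast intro: symI)
    show "trans (\<Inter>D)"
      using D congruenceD(5) by (blast intro: transI)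
  qed
qed (auto intro: congruenceD(3,7,8) [OF D])

lemma closure_system_congruence:
  "closure_system (carrier A \<times> carrier A) (nsr_congruence A)"
proof
  show "R \<subseteq> carrier A \<times> carrier A" if "nsr_congruence A R" for R
    using congruenceD(1,2) [OF that] by auto
qed (simp_all add: congruence_carrier congruence_Inter)

text \<open>A unary map that preserves each link of a chain preserves the chain. Multiplication by a
  fixed element on either side and the involution are such maps, and compatibility with these
  suffices for an equivalence to be a congruence.\<close>

lemma congruence_trancl_Un:
  assumes R: "nsr_congruence A R" and S: "nsr_congruence A S"
  shows "nsr_congruence A ((R \<union> S)\<^sup>+)"
proof -
  have map: "(f a, f b) \<in> (R \<union> S)\<^sup>+"
    if "(a, b) \<in> (R \<union> S)\<^sup>+" and "\<And>x y. (x, y) \<in> R \<union> S \<Longrightarrow> (f x, f y) \<in> R \<union> S" for f a b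
    using that(1) by induction (meson that(2) r_into_trancl' trancl_into_trancl)+
  show ?thesis
  proof (rule congruenceI)
    show "equiv (carrier A) ((R \<union> S)\<^sup>+)"
    proof (rule equivI)
      show "(R \<union> S)\<^sup>+ \<subseteq> carrier A \<times> carrier A"
        using congruenceD(1,2) [OF R] congruenceD(1,2) [OF S] by (intro trancl_subset_Sigma) auto
      show "refl_on (carrier A) ((R \<union> S)\<^sup>+)"
        using congruenceD(3) [OF R] by (auto intro: refl_onI)
      show "sym ((R \<union> S)\<^sup>+)"
        using congruenceD(4) [OF R] congruenceD(4) [OF S] by (intro sym_trancl symI) auto
    qed simp
    fix a b c assume ab: "(a, b) \<in> (R \<union> S)\<^sup>+" and c: "c \<in> carrier A"
    show "(a \<otimes> c, b \<otimes> c) \<in> (R \<union> S)\<^sup>+" "(c \<otimes> a, c \<otimes> b) \<in> (R \<union> S)\<^sup>+"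
      using c congruenceD(3,7) [OF R] congruenceD(3,7) [OF S] by (auto intro!: map [OF ab])
  next
    fix a b assume ab: "(a, b) \<in> (R \<union> S)\<^sup>+"
    show "(a\<^sup>\<alpha>, b\<^sup>\<alpha>) \<in> (R \<union> S)\<^sup>+"
      using congruenceD(8) [OF R] congruenceD(8) [OF S] by (auto intro!: map [OF ab])
  qed
qed

section \<open>Distributivity of the ideal lattice\<close>

lemma ideal_Int_hull_Un_subset:
  assumes I: "nsr_ideal A I" and J: "nsr_ideal A J" and K: "nsr_ideal A K"
  shows "I \<inter> (nsr_ideal A hull (J \<union> K)) \<subseteq> nsr_ideal A hull ((I \<inter> J) \<union> (I \<inter> K))"
proof
  interpret closure_system "carrier A" "nsr_ideal A"
    by (rule closure_system_ideal)
  define T where "T = nsr_ideal A hull ((I \<inter> J) \<union> (I \<inter> K))"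
  define R where "R = (ideal_rel A J \<union> ideal_rel A K)\<^sup>+"
  have T: "nsr_ideal A T"
    unfolding T_def using idealD(1) [OF I] by (intro hull_closed) auto
  have R: "nsr_congruence A R"
    unfolding R_def using J K by (intro congruence_trancl_Un congruence_ideal_rel)
  \<comment> \<open>The zero class of \<open>R\<close> is an ideal containing \<open>J\<close> and
    \<open>K\<close>, hence also the ideal they generate; so each element of the latter is joined to
    0 by a chain of links from the two relations.\<close>
  have "J \<union> K \<subseteq> zero_class R"
    using zero_class_ideal_rel [OF J] zero_class_ideal_rel [OF K]
    by (auto simp: zero_class_def R_def)
  then have hull: "nsr_ideal A hull (J \<union> K) \<subseteq> zero_class R"
    using ideal_zero_class [OF R] by (rule hull_minimal)
  fix a assume "a \<in> I \<inter> (nsr_ideal A hull (J \<union> K))"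
  then have aI: "a \<in> I" and "(\<zero>, a) \<in> R"
    using hull congruenceD(4) [OF R] by (auto simp: zero_class_def)
  have a [simp]: "a \<in> carrier A"
    using aI idealD(1) [OF I] by blast
  \<comment> \<open>By De Morgan this is the meet of \<open>a\<close> and \<open>x\<close>. As a
    polynomial in \<open>x\<close> it respects every congruence; it fixes 0 and \<open>a\<close>,
    and its values lie below \<open>a\<close>, hence in \<open>I\<close>.\<close>
  define meet where "meet x = (a\<^sup>\<alpha> \<oplus> x\<^sup>\<alpha>)\<^sup>\<alpha>" for x
  have meet_closed [simp]: "meet x \<in> carrier A" if "x \<in> carrier A" for x
    using that by (simp add: meet_def)
  have meet_I: "meet x \<in> I" if "x \<in> carrier A" for x
  proof (rule ideal_downward_closed [OF I aI])
    show "meet x \<preceq> a"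
      unfolding meet_def using that by (simp add: alpha_le_swap le_add_left)
  qed (use that in simp)
  have step: "(meet x, meet y) \<in> ideal_rel A (I \<inter> L)"
    if L: "nsr_ideal A L" and xy: "(x, y) \<in> ideal_rel A L" for L x y
  proof -
    have [simp]: "x \<in> carrier A" "y \<in> carrier A"
      using xy by (auto dest: ideal_rel_carrier)
    have "(meet x, meet y) \<in> ideal_rel A L"
      unfolding meet_def using congruence_ideal_rel [OF L] xy
      by (intro congruenceD(3,6,8)) auto
    \<comment> \<open>Both values lie in \<open>I\<close>, so both are related to 0 and therefore to
      each other.\<close>
    moreover have "(meet x, meet y) \<in> ideal_rel A I"
    proof -
      have "(meet x, \<zero>) \<in> ideal_rel A I" "(meet y, \<zero>) \<in> ideal_rel A I"
        using meet_I [of x] meet_I [of y] zero_class_ideal_rel [OF I]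
        by (auto simp: zero_class_def)
      then show ?thesis
        using ideal_rel_trans [OF I] ideal_rel_sym by meson
    qed
    ultimately show ?thesis
      by (simp add: ideal_rel_def)
  qed
  have sub: "ideal_rel A (I \<inter> J) \<subseteq> ideal_rel A T" "ideal_rel A (I \<inter> K) \<subseteq> ideal_rel A T"
    unfolding T_def by (auto intro!: ideal_rel_mono hull_inc)
  have step_T: "(meet x, meet y) \<in> ideal_rel A T"
    if "(x, y) \<in> ideal_rel A J \<union> ideal_rel A K" for x y
    using that step [OF J] step [OF K] sub by blast
  \<comment> \<open>Induction along the chain: the image of every link lies in the relation of
    \<open>T\<close>, which is transitive.\<close>
  have "(meet \<zero>, meet a) \<in> ideal_rel A T"
    using \<open>(\<zero>, a) \<in> R\<close> unfolding R_def
    by induction (use step_T ideal_rel_trans [OF T] in blast)+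
  moreover have "meet \<zero> = \<zero>"
    using one_greatest [of "a\<^sup>\<alpha>"] by (simp add: meet_def alpha_zero alpha_one nsr_le_def)
  moreover have "meet a = a"
    by (simp add: meet_def add_idem alpha_invol)
  ultimately have "(\<zero>, a) \<in> ideal_rel A T"
    by simp
  then show "a \<in> nsr_ideal A hull ((I \<inter> J) \<union> (I \<inter> K))"
    using ideal_rel_mem [OF T ideal_rel_sym] idealD(2) [OF T] unfolding T_def by blast
qed

lemma distributive_lattice_ideal: "distributive_lattice (incl_order (nsr_ideal A))"
proof -
  interpret closure_system "carrier A" "nsr_ideal A"
    by (rule closure_system_ideal)
  have "I \<inter> (nsr_ideal A hull (J \<union> K)) = nsr_ideal A hull ((I \<inter> J) \<union> (I \<inter> K))"
    if I: "nsr_ideal A I" and J: "nsr_ideal A J" and K: "nsr_ideal A K" for I J K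
  proof (intro subset_antisym ideal_Int_hull_Un_subset that)
    \<comment> \<open>The easy inclusion: this intersection is an ideal containing both generating
      intersections, so minimality of the hull applies.\<close>
    have "nsr_ideal A (I \<inter> (nsr_ideal A hull (J \<union> K)))"
      using idealD(1) [OF J] idealD(1) [OF K] by (intro Int_closed I hull_closed) auto
    then show "nsr_ideal A hull ((I \<inter> J) \<union> (I \<inter> K)) \<subseteq> I \<inter> (nsr_ideal A hull (J \<union> K))"
      by (intro hull_minimal) (auto intro: hull_inc)
  qed
  moreover have "nsr_ideal A (nsr_ideal A hull (J \<union> K))"
    if "nsr_ideal A J" "nsr_ideal A K" for J K
    using idealD(1) [OF that(1)] idealD(1) [OF that(2)] by (intro hull_closed) auto
  ultimately show ?thesis
    by (simp add: distributive_lattice_def lattice join_eq_hull meet_eq_Int Int_closed)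
qed

text \<open>The set containing only 0 is an ideal because it is the zero class of the identity
  congruence, and every ideal contains 0.\<close>

lemma hull_empty_ideal: "nsr_ideal A hull {} = {\<zero>}"
proof (rule hull_unique)
  have "zero_class (Id_on (carrier A)) = {\<zero>}"
    by (auto simp: zero_class_def)
  moreover have "nsr_congruence A (Id_on (carrier A))"
    by (rule congruenceI) (auto intro!: equivI refl_onI symI transI)
  ultimately show "nsr_ideal A {\<zero>}"
    using ideal_zero_class by metis
qed (auto dest: idealD(2))

end

section \<open>Transfer to the ideal lattice and the congruence lattice\<close>

lemma ideal_lattice_eq: "ideal_lattice A = incl_order (nsr_ideal A)"
  by (simp add: ideal_lattice_def incl_order_def)

lemma congruence_lattice_eq: "congruence_lattice A = incl_order (nsr_congruence A)"
  by (simp add: congruence_lattice_def incl_order_def)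

lemma ideal_generated_eq_hull: "ideal_generated A X = nsr_ideal A hull X"
  by (simp add: ideal_generated_def hull_def)

theorem theorem3:
  fixes A :: "('a, 'm) nsr_scheme"
  assumes "lukasiewicz_near_semiring A"
  shows "(\<forall>I\<in>carrier (ideal_lattice A). \<forall>J\<in>carrier (ideal_lattice A).
            I \<sqinter>\<^bsub>ideal_lattice A\<^esub> J = I \<inter> J \<and>
            I \<squnion>\<^bsub>ideal_lattice A\<^esub> J = ideal_generated A (I \<union> J))
       \<and> \<bottom>\<^bsub>ideal_lattice A\<^esub> = {\<zero>\<^bsub>A\<^esub>}
       \<and> \<top>\<^bsub>ideal_lattice A\<^esub> = carrier A
       \<and> bounded_lattice_iso (ideal_lattice A) (congruence_lattice A) (ideal_rel A)
       \<and> algebraic_lattice (ideal_lattice A)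
       \<and> distributive_lattice (ideal_lattice A)"
proof -
  interpret lukasiewicz_near_semiring A by (rule assms)
  interpret Id: closure_system "carrier A" "nsr_ideal A"
    by (rule closure_system_ideal)
  interpret Con: closure_system "carrier A \<times> carrier A" "nsr_congruence A"
    by (rule closure_system_congruence)
  have "bounded_lattice_iso (incl_order (nsr_ideal A)) (incl_order (nsr_congruence A)) (ideal_rel A)"
    using Id.bounded_lattice Con.bounded_lattice bij_betw_ideal_rel ideal_rel_subset_iff
    by (intro bounded_lattice_isoI) simp_all
  moreover have "algebraic_lattice (incl_order (nsr_ideal A))"
    using ideal_directed_Union by (rule Id.algebraic_lattice)
  ultimately show ?thesis
    using distributive_lattice_ideal hull_empty_ideal
    by (simp add: ideal_lattice_eq congruence_lattice_eq ideal_generated_eq_hull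
        Id.meet_eq_Int Id.join_eq_hull Id.top_eq Id.bottom_eq)
qed

end
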